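(* Let $G$ be any finite abstract simplicial complex. Then $\sum_{x\in G}\omega(x)\,\chi(S(x))=0$.
   Context: A finite abstract simplicial complex $G$ is a finite set of non-empty finite sets closed under taking non-empty subsets. For $x\in G$, $\dim(x)=|x|-1$ and $\omega(x)=(-1)^{\dim(x)}$. For any $A\subset G$, $\chi(A)=\sum_{x\in A}\omega(x)$. The star of $x$ is $U(x)=\{y\in G:x\subset y\}$, its closure $\overline{U(x)}$ is the set of all non-empty subsets of elements of $U(x)$, and the unit sphere of $x$ is $S(x)=\overline{U(x)}\setminus U(x)$. *)

theory Defs
  imports Main
begin

definition finite_abstract_simplicial_complex :: "'a set set \<Rightarrow> bool" where
  "finite_abstract_simplicial_complex G \<longleftrightarrow>
     finite G \<and>
     (\<forall>x\<in>G. finite x \<and> x \<noteq> {}) \<and>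
     (\<forall>x\<in>G. \<forall>y. y \<subseteq> x \<and> y \<noteq> {} \<longrightarrow> y \<in> G)"

(* The subtraction does not truncate on the finite non-empty sets of a complex. *)
definition simplex_dim :: "'a set \<Rightarrow> nat" where
  "simplex_dim x = card x - 1"

definition omega :: "'a set \<Rightarrow> int" where
  "omega x = (- 1) ^ simplex_dim x"

definition euler_char :: "'a set set \<Rightarrow> int" where
  "euler_char A = (\<Sum>x\<in>A. omega x)"

(* The inclusion is not strict: x belongs to its own star. *)
definition star :: "'a set set \<Rightarrow> 'a set \<Rightarrow> 'a set set" where
  "star G x = {y \<in> G. x \<subseteq> y}"

definition simplicial_closure :: "'a set set \<Rightarrow> 'a set set" where
  "simplicial_closure A = {z. z \<noteq> {} \<and> (\<exists>y\<in>A. z \<subseteq> y)}"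

definition unit_sphere :: "'a set set \<Rightarrow> 'a set \<Rightarrow> 'a set set" where
  "unit_sphere G x = simplicial_closure (star G x) - star G x"

end

(* Since S(x) is the closed star minus the star, the sum is
   sum_x omega(x) chi(closed star of x) - sum_x omega(x) chi(U(x)).  A closed star is a cone, so
   it has Euler characteristic 1 and the first sum is chi(G).  Exchanging the order of summation,
   the second sum is sum_y omega(y) chi(full simplex on y), and a full simplex is a cone as well,
   so the second sum is chi(G) too. *)
theory Submission
  imports Defs
begin

text \<open>A new vertex raises the dimension by one and flips the sign. Non-emptiness matters: by
  truncated subtraction \<open>{}\<close> and \<open>{v}\<close> both get dimension 0, hence the
  same sign.\<close>

lemma omega_insert:
  assumes "finite z" "z \<noteq> {}" "v \<notin> z"
  shows "omega (insert v z) = - omega z"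
proof -
  obtain n where "card z = Suc n"
    using assms by (cases "card z") auto
  then show ?thesis
    using assms by (simp add: omega_def simplex_dim_def)
qed

(* Toggling the apex v pairs off all simplices except {v} itself. *)
lemma euler_char_cone:
  assumes fin: "finite A"
    and simplices: "\<And>z. z \<in> A \<Longrightarrow> finite z \<and> z \<noteq> {}"
    and apex: "{v} \<in> A"
    and ins: "\<And>z. z \<in> A \<Longrightarrow> insert v z \<in> A"
    and del: "\<And>z. z \<in> A \<Longrightarrow> z \<noteq> {v} \<Longrightarrow> z - {v} \<in> A"
  shows "euler_char A = 1"
proof -
  \<comment> \<open>\<open>B\<close> is the base of the cone; the remaining simplices are
    \<open>{v}\<close> and those obtained by adding \<open>v\<close> to a member of
    \<open>B\<close>.\<close>
  define B where "B = {z \<in> A. v \<notin> z}"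
  have finB: "finite B"
    using fin by (simp add: B_def)
  have A_eq: "A = insert {v} (B \<union> insert v ` B)"
  proof (rule set_eqI)
    fix z
    have "z \<in> insert v ` B" if "z \<in> A" "v \<in> z" "z \<noteq> {v}"
      using that del[of z] by (intro image_eqI[of _ _ "z - {v}"]) (auto simp: B_def)
    then show "z \<in> A \<longleftrightarrow> z \<in> insert {v} (B \<union> insert v ` B)"
      using apex ins by (auto simp: B_def)
  qed
  \<comment> \<open>If \<open>insert v z = {v}\<close> with \<open>v \<notin> z\<close>, then
    \<open>z\<close> would be empty, but members of \<open>A\<close> are not.\<close>
  have apex_notin: "{v} \<notin> B \<union> insert v ` B"
    using simplices by (auto simp: B_def)
  have disj: "B \<inter> insert v ` B = {}"
    by (auto simp: B_def)
  have inj: "inj_on (insert v) B"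
    by (auto simp: B_def inj_on_def)
  have "euler_char A = omega {v} + (sum omega B + sum omega (insert v ` B))"
    unfolding euler_char_def A_eq
    using finB apex_notin disj by (simp add: sum.union_disjoint)
  \<comment> \<open>Each base simplex cancels against its join with \<open>v\<close>, so only
    \<open>omega {v} = 1\<close> survives.\<close>
  also have "sum omega (insert v ` B) = (\<Sum>z\<in>B. - omega z)"
    unfolding sum.reindex[OF inj] comp_def
    using simplices by (intro sum.cong omega_insert) (auto simp: B_def)
  finally show ?thesis
    by (simp add: sum_negf omega_def simplex_dim_def)
qed

text \<open>Any vertex of \<open>y\<close> serves as apex.\<close>

lemma euler_char_full_simplex:
  assumes "finite y" "y \<noteq> {}"
  shows "euler_char (Pow y - {{}}) = 1"
proof -
  obtain v where "v \<in> y"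
    using assms by blast
  then show ?thesis
    using assms by (intro euler_char_cone[where v = v]) (auto intro: finite_subset)
qed

lemma simplicial_closure_star_subset:
  assumes "finite_abstract_simplicial_complex G"
  shows "simplicial_closure (star G x) \<subseteq> G"
  using assms
  unfolding finite_abstract_simplicial_complex_def simplicial_closure_def star_def by blast

text \<open>Any vertex \<open>v\<close> of \<open>x\<close> serves as apex: a simplex
  \<open>z\<close> of the closed star lies in some \<open>y \<in> G\<close> containing
  \<open>x\<close>, hence \<open>v\<close>, so \<open>insert v z\<close> is still a face of
  \<open>y\<close>.\<close>

lemma euler_char_simplicial_closure_star:
  assumes G: "finite_abstract_simplicial_complex G" and x: "x \<in> G"
  shows "euler_char (simplicial_closure (star G x)) = 1"
proof -
  have fin: "finite G" and simplices: "\<And>z. z \<in> G \<Longrightarrow> finite z \<and> z \<noteq> {}"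
    using G by (auto simp: finite_abstract_simplicial_complex_def)
  obtain v where v: "v \<in> x"
    using simplices x by blast
  note sub = simplicial_closure_star_subset[OF G, of x]
  show ?thesis
  proof (rule euler_char_cone)
    show "finite (simplicial_closure (star G x))"
      using sub fin finite_subset by blast
    show "finite z \<and> z \<noteq> {}" if "z \<in> simplicial_closure (star G x)" for z
      using that sub simplices by blast
    show "{v} \<in> simplicial_closure (star G x)"
      using v x by (auto simp: simplicial_closure_def star_def)
    show "insert v z \<in> simplicial_closure (star G x)"
      if "z \<in> simplicial_closure (star G x)" for z
      using that v by (auto simp: simplicial_closure_def star_def)
    show "z - {v} \<in> simplicial_closure (star G x)"
      if "z \<in> simplicial_closure (star G x)" "z \<noteq> {v}" for z
      using that by (auto simp: simplicial_closure_def star_def)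
  qed
qed

lemma euler_char_unit_sphere:
  assumes G: "finite_abstract_simplicial_complex G" and x: "x \<in> G"
  shows "euler_char (unit_sphere G x) = 1 - euler_char (star G x)"
proof -
  have "finite (simplicial_closure (star G x))"
    using simplicial_closure_star_subset[OF G] G
    by (auto simp: finite_abstract_simplicial_complex_def intro: finite_subset)
  \<comment> \<open>This inclusion, which uses that simplices are non-empty, lets the sum over the
    set difference split.\<close>
  moreover have "star G x \<subseteq> simplicial_closure (star G x)"
    using G by (auto simp: finite_abstract_simplicial_complex_def simplicial_closure_def star_def)
  ultimately show ?thesis
    using euler_char_simplicial_closure_star[OF G x]
    by (simp add: euler_char_def unit_sphere_def sum_diff)
qed

lemma sum_omega_euler_char_star:
  assumes G: "finite_abstract_simplicial_complex G"
  shows "(\<Sum>x\<in>G. omega x * euler_char (star G x)) = euler_char G"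
proof -
  have fin: "finite G" and simplices: "\<And>y. y \<in> G \<Longrightarrow> finite y \<and> y \<noteq> {}"
    using G by (auto simp: finite_abstract_simplicial_complex_def)
  \<comment> \<open>Closure under non-empty subsets turns the inner sum after the exchange into one
    over a full simplex.\<close>
  have faces: "{x \<in> G. x \<subseteq> y} = Pow y - {{}}" if "y \<in> G" for y
    using G that unfolding finite_abstract_simplicial_complex_def by blast
  have "(\<Sum>x\<in>G. omega x * euler_char (star G x))
      = (\<Sum>x\<in>G. \<Sum>y | y \<in> G \<and> x \<subseteq> y. omega x * omega y)"
    by (simp add: euler_char_def star_def sum_distrib_left)
  also have "\<dots> = (\<Sum>y\<in>G. \<Sum>x | x \<in> G \<and> x \<subseteq> y. omega x * omega y)"
    by (rule sum.swap_restrict[OF fin fin])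
  also have "\<dots> = (\<Sum>y\<in>G. euler_char (Pow y - {{}}) * omega y)"
    by (simp add: faces euler_char_def sum_distrib_right)
  also have "\<dots> = (\<Sum>y\<in>G. omega y)"
    by (rule sum.cong) (simp_all add: euler_char_full_simplex simplices)
  finally show ?thesis
    by (simp add: euler_char_def)
qed

theorem mainTheorem10:
  fixes G :: "'a set set"
  assumes "finite_abstract_simplicial_complex G"
  shows "(\<Sum>x\<in>G. omega x * euler_char (unit_sphere G x)) = 0"
proof -
  have "(\<Sum>x\<in>G. omega x * euler_char (unit_sphere G x))
      = (\<Sum>x\<in>G. omega x - omega x * euler_char (star G x))"
    by (rule sum.cong) (simp_all add: euler_char_unit_sphere[OF assms] right_diff_distrib)
  also have "\<dots> = euler_char G - (\<Sum>x\<in>G. omega x * euler_char (star G x))"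
    by (simp add: sum_subtractf euler_char_def)
  finally show ?thesis
    by (simp add: sum_omega_euler_char_star[OF assms])
qed

end
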